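(* Let $n\geq 2$ and let $A=[a_{ij}]\in \mathbb{C}^{n\times n}$ be a DD matrix. Then the following conditions are equivalent: (1) $T(A)=\emptyset$, or for each $i_0\in T(A)$ there exists a nonzero elements chain of the form $a_{i_0i_1},a_{i_1i_2},\ldots,a_{i_{r-1}i_r}$ with $i_r\in \overline{T(A)}$; (2) the matrix $A$ has nonzero diagonal entries and $T(A)$ is an interwoven set of indices for $A$.
   Context: Let $N=\{1,2,\ldots,n\}$ and, for $S\subseteq N$, let $\overline{S}=N\setminus S$. For $A=[a_{ij}]\in\mathbb{C}^{n\times n}$ and $i\in N$, put $r_i(A)=\sum_{j\in N\setminus\{i\}}|a_{ij}|$. The matrix $A$ is DD (diagonally dominant) if $|a_{ii}|\geq r_i(A)$ for all $i\in N$. Let $T(A)=\{i\in N : |a_{ii}|\leq r_i(A)\}$ be the set of indices of rows that are not strictly diagonally dominant. A nonzero elements chain $a_{i_0i_1},a_{i_1i_2},\ldots,a_{i_{r-1}i_r}$ (with $r\ge 1$) is a sequence of entries of $A$ all of which are nonzero; that is, there is a path from $i_0$ to $i_r$ in the directed graph of $A$ (vertices $N$, an edge from $i$ to $j$ whenever $a_{ij}\neq 0$). A proper subset $S$ of $N$ (possibly empty, $S\ne N$) is called interwoven for the matrix $A$ if $|S|\leq 1$, or $|S|=s>1$ and there exist distinct numbers $p_1,p_2,\ldots,p_{s-1}\in S$ and (not necessarily distinct) numbers $q_1,q_2,\ldots,q_{s-1}$ such that $q_1\in\overline{S}$, $a_{p_1q_1}\neq 0$, and for every $i\in\{2,3,\ldots,s-1\}$,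 $q_i\in\overline{S}\cup\{p_1,p_2,\ldots,p_{i-1}\}$ and $a_{p_iq_i}\neq 0$. (Saying that $T(A)$ is interwoven includes that $T(A)$ is a proper subset of $N$.) *)

theory Defs
  imports "HOL-Analysis.Analysis"
begin

text \<open>The index set \<open>N\<close> is \<open>UNIV\<close> of a finite type, so that \<open>n = CARD('n)\<close>
  and complements of index sets are written \<open>- S\<close>.\<close>

definition deleted_row_sum :: "complex^'n^'n \<Rightarrow> 'n \<Rightarrow> real" where
  "deleted_row_sum A i = (\<Sum>j\<in>UNIV - {i}. norm (A $ i $ j))"

definition diag_dominant :: "complex^'n^'n \<Rightarrow> bool" where
  "diag_dominant A \<longleftrightarrow> (\<forall>i. norm (A $ i $ i) \<ge> deleted_row_sum A i)"

definition non_strict_rows :: "complex^'n^'n \<Rightarrow> 'n set" where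
  "non_strict_rows A = {i. norm (A $ i $ i) \<le> deleted_row_sum A i}"

text \<open>\<open>nonzero_chain A r c\<close>: the entries with index pairs \<open>(c 0, c 1), \<dots>, (c (r - 1), c r)\<close>
  are all nonzero. Only the values \<open>c 0, \<dots>, c r\<close> matter; indices may repeat.\<close>

definition nonzero_chain :: "complex^'n^'n \<Rightarrow> nat \<Rightarrow> (nat \<Rightarrow> 'n) \<Rightarrow> bool" where
  "nonzero_chain A r c \<longleftrightarrow> r \<ge> 1 \<and> (\<forall>k<r. A $ c k $ c (Suc k) \<noteq> 0)"

text \<open>The sequences \<open>p\<close> and \<open>q\<close> are relevant only at the arguments \<open>1, \<dots>, card S - 1\<close>.\<close>

definition interwoven :: "complex^'n^'n \<Rightarrow> 'n set \<Rightarrow> bool" where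
  "interwoven A S \<longleftrightarrow> S \<subset> UNIV \<and>
     (card S \<le> 1 \<or>
      card S > 1 \<and>
      (\<exists>p q :: nat \<Rightarrow> 'n.
         inj_on p {1..card S - 1} \<and> p ` {1..card S - 1} \<subseteq> S \<and>
         q 1 \<in> - S \<and> A $ p 1 $ q 1 \<noteq> 0 \<and>
         (\<forall>i\<in>{2..card S - 1}. q i \<in> - S \<union> p ` {1..i - 1} \<and> A $ p i $ q i \<noteq> 0)))"

end

theory Submission
  imports Defs
begin

text \<open>
  Let \<open>T\<close> be the set of non-strict rows and read the nonzero entries of \<open>A\<close> as the edges of a
  directed graph on the row indices. Condition (1) says that every vertex of \<open>T\<close> has a path that
  leaves \<open>T\<close>. Being interwoven is a statement about the same graph: \<open>T\<close> is not the whole index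
  set, and all vertices of \<open>T\<close> except at most one can be listed so that each has an edge to the
  outside of \<open>T\<close> or to a vertex listed before it.

  From (1) to (2), the list is built greedily. As long as some vertex \<open>t\<close> of \<open>T\<close> is not listed, the
  path from \<open>t\<close> out of \<open>T\<close> has to leave the set of unlisted vertices somewhere, and the edge on
  which it does so starts in a vertex that may be listed next
  (\<open>exists_absorbing_enumeration\<close>). In fact all of \<open>T\<close> can be listed.

  From (2) to (1), following the edges to earlier vertices gives a path out of \<open>T\<close> for every
  listed vertex (\<open>listed_reaches_complement\<close>). At most one vertex of \<open>T\<close> remains.

  Only for this vertex, and for the diagonal, do the absolute values of the entries matter. A
  non-strict row with nonzero diagonal entry has a nonzero entry off the diagonal, so the remaining
  vertex has an edge to a different vertex, which lies outside \<open>T\<close> or is listed. Conversely, in a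
  diagonally dominant matrix a row with zero diagonal entry vanishes; no path starts in its index,
  and it is non-strict, so (1) excludes it.
\<close>

section \<open>The directed graph of a matrix\<close>

definition matrix_digraph :: "complex^'n^'n \<Rightarrow> ('n \<times> 'n) set" where
  "matrix_digraph A = {(i, j). A $ i $ j \<noteq> 0}"

lemma ex_nonzero_chain_iff_trancl:
  "(\<exists>r c. nonzero_chain A r c \<and> c 0 = i \<and> c r \<in> X) \<longleftrightarrow> (\<exists>j\<in>X. (i, j) \<in> (matrix_digraph A)\<^sup>+)"
proof -
  have "(i, j) \<in> (matrix_digraph A)\<^sup>+ \<longleftrightarrow> (\<exists>r c. nonzero_chain A r c \<and> c 0 = i \<and> c r = j)" for j
    unfolding trancl_power relpow_fun_conv nonzero_chain_def matrix_digraph_def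
    by (auto simp: Suc_le_eq)
  then show ?thesis
    by (simp only:) blast
qed

text \<open>The cases of the definition merge into one condition: for the first index the set
  \<open>p ` {1..i - 1}\<close> is empty, and for a set with at most one element there is no index at all. The
  successors \<open>q\<close> become an existential quantifier, which suits proofs by induction on the index.\<close>

lemma interwoven_iff:
  "interwoven A S \<longleftrightarrow> S \<noteq> UNIV \<and>
     (\<exists>p :: nat \<Rightarrow> 'n. inj_on p {1..card S - 1} \<and> p ` {1..card S - 1} \<subseteq> S \<and>
        (\<forall>i\<in>{1..card S - 1}. \<exists>j\<in>- S \<union> p ` {1..i - 1}. (p i, j) \<in> matrix_digraph A))"
  for A :: "complex^'n^'n"
proof (cases "card S \<le> 1")
  case True
  then have "{1..card S - 1} = {}"
    by simp
  with True show ?thesis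
    by (auto simp: interwoven_def)
next
  case False
  then have split: "{1..card S - 1} = insert 1 {2..card S - 1}"
    by auto
  have "(\<exists>q :: nat \<Rightarrow> 'n. q 1 \<in> - S \<and> A $ p 1 $ q 1 \<noteq> 0 \<and>
          (\<forall>i\<in>{2..card S - 1}. q i \<in> - S \<union> p ` {1..i - 1} \<and> A $ p i $ q i \<noteq> 0))
      \<longleftrightarrow> (\<forall>i\<in>{1..card S - 1}. \<exists>j\<in>- S \<union> p ` {1..i - 1}. (p i, j) \<in> matrix_digraph A)"
    (is "?L \<longleftrightarrow> ?R") for p :: "nat \<Rightarrow> 'n"
  proof -
    have "?R \<longleftrightarrow> (\<exists>q. \<forall>i\<in>{1..card S - 1}. q i \<in> - S \<union> p ` {1..i - 1} \<and> A $ p i $ q i \<noteq> 0)"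
      unfolding Bex_def bchoice_iff matrix_digraph_def by auto
    also have "\<dots> \<longleftrightarrow> ?L"
      unfolding split by simp
    finally show ?thesis
      by simp
  qed
  with False show ?thesis
    unfolding interwoven_def by (auto simp: psubset_eq)
qed

section \<open>Reaching the complement of a set in a finite digraph\<close>

text \<open>A path that leaves \<open>X\<close> crosses its boundary on one of its edges.\<close>

lemma trancl_leaving_edge:
  assumes "(x, y) \<in> R\<^sup>+" "x \<in> X" "y \<notin> X"
  obtains u v where "u \<in> X" "v \<notin> X" "(u, v) \<in> R"
proof -
  have "\<not> R `` X \<subseteq> X"
    using assms Image_closed_trancl[of R X] trancl_into_rtrancl[OF assms(1)] by blast
  then show thesis
    using that by blast
qed

text \<open>The vertices listed so far are removed from \<open>S\<close>; what is left is not empty and has a path out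
  of \<open>S\<close>, so it has an edge to its own complement, which consists of the outside of \<open>S\<close> and the
  vertices already listed.\<close>

lemma exists_absorbing_enumeration:
  fixes R :: "('a \<times> 'a) set"
  assumes reach: "\<And>x. x \<in> S \<Longrightarrow> \<exists>y\<in>- S. (x, y) \<in> R\<^sup>+"
    and "k \<le> card S"
  shows "\<exists>p :: nat \<Rightarrow> 'a. inj_on p {1..k} \<and> p ` {1..k} \<subseteq> S \<and>
           (\<forall>i\<in>{1..k}. \<exists>j\<in>- S \<union> p ` {1..i - 1}. (p i, j) \<in> R)"
  using \<open>k \<le> card S\<close>
proof (induction k)
  case 0
  then show ?case by simp
next
  case (Suc k)
  have "k \<le> card S"
    using Suc.prems by simp
  from Suc.IH[OF this] obtain p :: "nat \<Rightarrow> 'a" where inj: "inj_on p {1..k}"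
    and sub: "p ` {1..k} \<subseteq> S"
    and edge: "\<And>i. i \<in> {1..k} \<Longrightarrow> \<exists>j\<in>- S \<union> p ` {1..i - 1}. (p i, j) \<in> R"
    by blast
  have "card (p ` {1..k}) < card S"
    using inj Suc.prems by (simp add: card_image)
  then have "p ` {1..k} \<noteq> S"
    by blast
  with sub obtain t where t: "t \<in> S - p ` {1..k}"
    by blast
  with reach obtain y where "y \<in> - S" "(t, y) \<in> R\<^sup>+"
    by blast
  then have "y \<notin> S - p ` {1..k}"
    by simp
  with \<open>(t, y) \<in> R\<^sup>+\<close> t obtain u v where u: "u \<in> S - p ` {1..k}"
    and v: "v \<notin> S - p ` {1..k}" and uv: "(u, v) \<in> R"
    by (rule trancl_leaving_edge)
  define p' where "p' = p(Suc k := u)"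
  have new: "p' (Suc k) = u"
    by (simp add: p'_def)
  have p': "p' i = p i" if "i \<le> k" for i
    using that by (simp add: p'_def)
  have img: "p' ` {1..i} = p ` {1..i}" if "i \<le> k" for i
    using that p' by (auto intro!: image_cong)
  have split: "{1..Suc k} = insert (Suc k) {1..k}"
    by auto
  have "inj_on p' {1..k}"
    using inj p' inj_on_cong[of "{1..k}" p' p] by simp
  then have "inj_on p' {1..Suc k}"
    using u img[of k] new unfolding split by simp
  moreover have "p' ` {1..Suc k} \<subseteq> S"
    using sub u img[of k] new unfolding split by simp
  moreover have "\<exists>j\<in>- S \<union> p' ` {1..i - 1}. (p' i, j) \<in> R" if "i \<in> {1..Suc k}" for i
  proof (cases "i = Suc k")
    case True
    then show ?thesis
      using uv v img[of k] new by auto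
  next
    case False
    then have "i \<in> {1..k}"
      using that by auto
    then show ?thesis
      using edge[of i] p'[of i] img[of "i - 1"] by auto
  qed
  ultimately show ?case
    by blast
qed

lemma listed_reaches_complement:
  fixes p :: "nat \<Rightarrow> 'a"
  assumes edge: "\<And>i. i \<in> {1..k} \<Longrightarrow> \<exists>j\<in>- S \<union> p ` {1..i - 1}. (p i, j) \<in> R"
    and "i \<in> {1..k}"
  shows "\<exists>y\<in>- S. (p i, y) \<in> R\<^sup>+"
  using \<open>i \<in> {1..k}\<close>
proof (induction i rule: less_induct)
  case (less i)
  from edge[OF less.prems] obtain j where j: "j \<in> - S \<union> p ` {1..i - 1}" "(p i, j) \<in> R"
    by blast
  show ?case
  proof (cases "j \<in> - S")
    case True
    with j show ?thesis by blast
  next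
    case False
    with j obtain m where "m \<in> {1..i - 1}" "j = p m"
      by blast
    with less have "\<exists>y\<in>- S. (j, y) \<in> R\<^sup>+"
      by auto
    with j show ?thesis
      by (meson trancl_into_trancl2)
  qed
qed

section \<open>Diagonal dominance and nonzero entries\<close>

lemma diag_dominant_diag_nonzero:
  assumes "diag_dominant A" "A $ i $ j \<noteq> 0"
  shows "A $ i $ i \<noteq> 0"
proof (cases "j = i")
  case True
  with assms show ?thesis by simp
next
  case False
  have "0 < norm (A $ i $ j)"
    using assms by simp
  also have "\<dots> \<le> deleted_row_sum A i"
    unfolding deleted_row_sum_def using False by (intro member_le_sum) auto
  also have "\<dots> \<le> norm (A $ i $ i)"
    using assms by (simp add: diag_dominant_def)
  finally show ?thesis by simp
qed

lemma strict_row_diag_nonzero: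
  assumes "i \<notin> non_strict_rows A"
  shows "A $ i $ i \<noteq> 0"
proof -
  have "0 \<le> deleted_row_sum A i"
    unfolding deleted_row_sum_def by (intro sum_nonneg) simp
  with assms show ?thesis
    by (auto simp: non_strict_rows_def)
qed

lemma non_strict_row_off_diag_nonzero:
  assumes "i \<in> non_strict_rows A" "A $ i $ i \<noteq> 0"
  obtains j where "j \<noteq> i" "A $ i $ j \<noteq> 0"
proof -
  have "deleted_row_sum A i \<noteq> 0"
    using assms by (auto simp: non_strict_rows_def)
  then obtain j where "j \<in> UNIV - {i}" "norm (A $ i $ j) \<noteq> 0"
    unfolding deleted_row_sum_def by (rule sum.not_neutral_contains_not_neutral)
  then show thesis
    by (intro that) auto
qed

section \<open>Chains out of the non-strict rows\<close>

lemma interwoven_if_reaches_complement: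
  fixes A :: "complex^'n^'n"
  assumes reach: "\<And>x. x \<in> S \<Longrightarrow> \<exists>y\<in>- S. (x, y) \<in> (matrix_digraph A)\<^sup>+"
  shows "interwoven A S"
proof -
  have "S \<noteq> UNIV"
    using reach by auto
  with exists_absorbing_enumeration[of S "matrix_digraph A" "card S - 1", OF reach]
  show ?thesis
    unfolding interwoven_iff by auto
qed

text \<open>The listed elements of an interwoven set reach its complement, and at most one element is not
  listed. The hypothesis on edges to a different vertex is what that element needs: a loop would
  not lead it to the others.\<close>

lemma interwoven_reaches_complement:
  fixes A :: "complex^'n^'n"
  assumes "interwoven A S"
    and off_diag: "\<And>x. x \<in> S \<Longrightarrow> \<exists>y. y \<noteq> x \<and> (x, y) \<in> matrix_digraph A"
    and "x \<in> S"
  shows "\<exists>y\<in>- S. (x, y) \<in> (matrix_digraph A)\<^sup>+"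
proof -
  let ?R = "matrix_digraph A"
  from assms(1) obtain p :: "nat \<Rightarrow> 'n" where inj: "inj_on p {1..card S - 1}"
    and sub: "p ` {1..card S - 1} \<subseteq> S"
    and "\<forall>i\<in>{1..card S - 1}. \<exists>j\<in>- S \<union> p ` {1..i - 1}. (p i, j) \<in> ?R"
    unfolding interwoven_iff by (elim conjE exE)
  then have edge: "\<exists>j\<in>- S \<union> p ` {1..i - 1}. (p i, j) \<in> ?R" if "i \<in> {1..card S - 1}" for i
    using that by blast
  define P where "P = p ` {1..card S - 1}"
  have listed: "\<exists>y\<in>- S. (z, y) \<in> ?R\<^sup>+" if "z \<in> P" for z
  proof -
    from that obtain i where "i \<in> {1..card S - 1}" "z = p i"
      unfolding P_def by (rule imageE)
    with listed_reaches_complement[of "card S - 1" S p ?R, OF edge] show ?thesis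
      by simp
  qed
  show ?thesis
  proof (cases "x \<in> P")
    case True
    then show ?thesis by (rule listed)
  next
    case False
    have card_P: "card P = card S - 1"
      using inj by (simp add: P_def card_image)
    have "card S > 0"
      using \<open>x \<in> S\<close> by (auto simp: card_gt_0_iff)
    have "card (insert x P) = card S"
      using False card_P \<open>card S > 0\<close> by simp
    then have S: "S = insert x P"
      using sub \<open>x \<in> S\<close> unfolding P_def[symmetric] using card_subset_eq[of S "insert x P"] by auto
    from off_diag[OF \<open>x \<in> S\<close>] obtain y where y: "y \<noteq> x" "(x, y) \<in> ?R"
      by blast
    with S have "y \<in> - S \<or> y \<in> P"
      by blast
    with y(2) listed show ?thesis
      by (meson r_into_trancl trancl_into_trancl2)
  qed
qed

theorem theorem3:
  fixes A :: "complex^'n^'n"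
  assumes "CARD('n) \<ge> 2"
    and "diag_dominant A"
  shows "(non_strict_rows A = {} \<or>
          (\<forall>i\<^sub>0\<in>non_strict_rows A.
             \<exists>r c. nonzero_chain A r c \<and> c 0 = i\<^sub>0 \<and> c r \<in> - non_strict_rows A))
     \<longleftrightarrow> ((\<forall>i. A $ i $ i \<noteq> 0) \<and> interwoven A (non_strict_rows A))"
proof -
  let ?T = "non_strict_rows A" and ?R = "matrix_digraph A"
  have "(\<forall>x\<in>?T. \<exists>y\<in>- ?T. (x, y) \<in> ?R\<^sup>+) \<longleftrightarrow> (\<forall>i. A $ i $ i \<noteq> 0) \<and> interwoven A ?T"
  proof (intro iffI conjI allI)
    assume reach: "\<forall>x\<in>?T. \<exists>y\<in>- ?T. (x, y) \<in> ?R\<^sup>+"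
    then show "interwoven A ?T"
      by (intro interwoven_if_reaches_complement) blast
    show "A $ i $ i \<noteq> 0" for i
    proof (cases "i \<in> ?T")
      case True
      with reach obtain j where "(i, j) \<in> ?R"
        by (meson tranclD)
      with assms(2) show ?thesis
        by (auto simp: matrix_digraph_def dest: diag_dominant_diag_nonzero)
    qed (rule strict_row_diag_nonzero)
  next
    assume *: "(\<forall>i. A $ i $ i \<noteq> 0) \<and> interwoven A ?T"
    then have off_diag: "\<exists>y. y \<noteq> x \<and> (x, y) \<in> ?R" if "x \<in> ?T" for x
      using non_strict_row_off_diag_nonzero[OF that] unfolding matrix_digraph_def by blast
    from * show "\<forall>x\<in>?T. \<exists>y\<in>- ?T. (x, y) \<in> ?R\<^sup>+"
      using interwoven_reaches_complement[of A ?T, OF _ off_diag] by simp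
  qed
  then show ?thesis
    unfolding ex_nonzero_chain_iff_trancl by blast
qed

end
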